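(* The solution to the differential equation $$\nu''-\frac{1}{40}Q\nu=0,$$ where $Q=P^2-6P'$ and $P$ is a solution of the generalised Chazy equation with parameter $k=\frac23$, is given by $\nu=\frac{u}{v}$, where $v$ is a solution to the second-order differential equation associated to the $k=\frac23$ generalised Chazy equation and $u$ is a solution to the second-order differential equation associated to the $k=2$ generalised Chazy equation.
   Context: Primes denote $\frac{d}{dx}$; $P$ and $\nu$ are functions of $x$. The generalised Chazy equation with parameter $k$ is $$y'''-2yy''+3y'^2-\frac{4}{36-k^2}(6y'-y^2)^2=0.$$ Its solution is given as follows. For constants $(\alpha,\beta,\gamma)$ let $$V=\frac{1-\beta^2}{s^2}+\frac{1-\gamma^2}{(s-1)^2}+\frac{\beta^2+\gamma^2-\alpha^2-1}{s(s-1)},$$ let $s=s(x)$ be a solution of the Schwarzian differential equation $\{s,x\}+\frac12(s')^2V=0$, where $\{s,x\}=\frac{d}{dx}\left(\frac{s''}{s'}\right)-\frac12\left(\frac{s''}{s'}\right)^2$, and put $$w_1=-\frac12\frac{d}{dx}\log\frac{s'}{s(s-1)},\quad w_2=-\frac12\frac{d}{dx}\log\frac{s'}{s-1},\quad w_3=-\frac12\frac{d}{dx}\log\frac{s'}{s}.$$ Then the generalised Chazy equation with parameter $k$ is solved by: - $y=-2w_1-2w_2-2w_3$ when $(\alpha,\beta,\gamma)=(\frac13,\frac13,\frac2k)$ or $(\frac2k,\frac2k,\frac2k)$; - $y=-w_1-2w_2-3w_3$ when $(\alpha,\beta,\gamma)=(\frac1k,\frac13,\frac12)$ or $(\frac1k,\frac2k,\frac12)$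 or $(\frac1k,\frac13,\frac3k)$; - $y=-w_1-w_2-4w_3$ when $(\alpha,\beta,\gamma)=(\frac1k,\frac1k,\frac4k)$ or $(\frac1k,\frac1k,\frac23)$; permutations of $w_1,w_2,w_3$ in $y$ correspond to permutations of the values $\alpha,\beta,\gamma$. The second-order differential equation associated to the generalised Chazy equation with parameter $k$ is $u_{ss}+\frac14Vu=0$, with the potential $V$ above and $(\alpha,\beta,\gamma)$ one of the triples above for that $k$. It corresponds to the Schwarzian differential equation after exchanging dependent and independent variables: $x=\frac{u_2}{u_1}$ with $u_1,u_2$ linearly independent solutions of $u_{ss}+\frac14Vu=0$. In the formula $\nu=\frac uv$, the functions $u$ and $v$ are regarded as functions of $x$ through $s=s(x)$.
   Formalization: Here v is not an arbitrary solution (for which the claim fails) but the denominator in x = v2/v, on a domain where this inverts s; P is given from s by the stated formula, and u solves the k=2 equation for the same family and permutation of triples. *)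

theory Defs
  imports "HOL-Complex_Analysis.Complex_Analysis" "HOL-Combinatorics.Permutations"
begin

text \<open>
  All functions are complex functions, holomorphic on an open set on which the
  differential equations are imposed.
\<close>

definition chazy_solution :: "complex \<Rightarrow> complex set \<Rightarrow> (complex \<Rightarrow> complex) \<Rightarrow> bool" where
  "chazy_solution k X y \<longleftrightarrow> y holomorphic_on X \<and>
     (\<forall>x\<in>X. (deriv ^^ 3) y x - 2 * y x * (deriv ^^ 2) y x + 3 * (deriv y x)\<^sup>2
            - 4 / (36 - k\<^sup>2) * (6 * deriv y x - (y x)\<^sup>2)\<^sup>2 = 0)"

text \<open>The exponent triple \<open>(\<alpha>, \<beta>, \<gamma>)\<close> is passed as a list of length three.\<close>

definition potential :: "complex list \<Rightarrow> complex \<Rightarrow> complex" where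
  "potential abc s = (let \<alpha> = abc ! 0; \<beta> = abc ! 1; \<gamma> = abc ! 2 in
     (1 - \<beta>\<^sup>2) / s\<^sup>2 + (1 - \<gamma>\<^sup>2) / (s - 1)\<^sup>2 + (\<beta>\<^sup>2 + \<gamma>\<^sup>2 - \<alpha>\<^sup>2 - 1) / (s * (s - 1)))"

definition schwarzian :: "(complex \<Rightarrow> complex) \<Rightarrow> complex \<Rightarrow> complex" where
  "schwarzian s x = deriv (\<lambda>t. (deriv ^^ 2) s t / deriv s t) x
                    - 1 / 2 * ((deriv ^^ 2) s x / deriv s x)\<^sup>2"

text \<open>
  The nonvanishing conditions are those under which the Schwarzian derivative and the
  potential are defined.
\<close>

definition schwarzian_solution ::
  "(complex \<Rightarrow> complex) \<Rightarrow> complex set \<Rightarrow> (complex \<Rightarrow> complex) \<Rightarrow> bool" where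
  "schwarzian_solution V X s \<longleftrightarrow> s holomorphic_on X \<and>
     (\<forall>x\<in>X. deriv s x \<noteq> 0 \<and> s x \<noteq> 0 \<and> s x \<noteq> 1 \<and>
            schwarzian s x + 1 / 2 * (deriv s x)\<^sup>2 * V (s x) = 0)"

text \<open>\<open>d/dx log f\<close>, independent of the branch of the logarithm.\<close>

definition dlog :: "(complex \<Rightarrow> complex) \<Rightarrow> complex \<Rightarrow> complex" where
  "dlog f x = deriv f x / f x"

definition w1 :: "(complex \<Rightarrow> complex) \<Rightarrow> complex \<Rightarrow> complex" where
  "w1 s x = - 1 / 2 * dlog (\<lambda>t. deriv s t / (s t * (s t - 1))) x"

definition w2 :: "(complex \<Rightarrow> complex) \<Rightarrow> complex \<Rightarrow> complex" where
  "w2 s x = - 1 / 2 * dlog (\<lambda>t. deriv s t / (s t - 1)) x"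

definition w3 :: "(complex \<Rightarrow> complex) \<Rightarrow> complex \<Rightarrow> complex" where
  "w3 s x = - 1 / 2 * dlog (\<lambda>t. deriv s t / s t) x"

definition w_combination :: "complex list \<Rightarrow> (complex \<Rightarrow> complex) \<Rightarrow> complex \<Rightarrow> complex" where
  "w_combination c s x = - (c ! 0) * w1 s x - (c ! 1) * w2 s x - (c ! 2) * w3 s x"

text \<open>
  A family consists of the coefficients \<open>c\<close> in \<open>y = - c\<^sub>1 w\<^sub>1 - c\<^sub>2 w\<^sub>2 - c\<^sub>3 w\<^sub>3\<close> and of the
  exponent triple as a function of the parameter \<open>k\<close>. Keeping the dependence on \<open>k\<close>
  makes it possible to compare one family at two different parameters.
\<close>

definition standard_families :: "(complex list \<times> (complex \<Rightarrow> complex list)) set" where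
  "standard_families =
    {([2, 2, 2], \<lambda>k. [1/3, 1/3, 2/k]),
     ([2, 2, 2], \<lambda>k. [2/k, 2/k, 2/k]),
     ([1, 2, 3], \<lambda>k. [1/k, 1/3, 1/2]),
     ([1, 2, 3], \<lambda>k. [1/k, 2/k, 1/2]),
     ([1, 2, 3], \<lambda>k. [1/k, 1/3, 3/k]),
     ([1, 1, 4], \<lambda>k. [1/k, 1/k, 4/k]),
     ([1, 1, 4], \<lambda>k. [1/k, 1/k, 2/3])}"

text \<open>Coefficients and exponents are permuted simultaneously.\<close>

definition chazy_families :: "(complex list \<times> (complex \<Rightarrow> complex list)) set" where
  "chazy_families =
    {(permute_list p c, \<lambda>k. permute_list p (abc k)) | p c abc.
       p permutes {..<3} \<and> (c, abc) \<in> standard_families}"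

text \<open>Solutions of \<open>u\<^sub>s\<^sub>s + V u / 4 = 0\<close>.\<close>

definition second_order_solution ::
  "(complex \<Rightarrow> complex) \<Rightarrow> complex set \<Rightarrow> (complex \<Rightarrow> complex) \<Rightarrow> bool" where
  "second_order_solution V S u \<longleftrightarrow> u holomorphic_on S \<and>
     (\<forall>z\<in>S. (deriv ^^ 2) u z + 1 / 4 * V z * u z = 0)"

definition lin_indep_on ::
  "complex set \<Rightarrow> (complex \<Rightarrow> complex) \<Rightarrow> (complex \<Rightarrow> complex) \<Rightarrow> bool" where
  "lin_indep_on S f g \<longleftrightarrow>
     (\<forall>a b. (\<forall>z\<in>S. a * f z + b * g z = 0) \<longrightarrow> a = 0 \<and> b = 0)"

text \<open>
  \<open>x = u\<^sub>2 / u\<^sub>1\<close> inverts \<open>s = s(x)\<close> on \<open>X\<close>. In particular \<open>s\<close> is injective on \<open>X\<close>, so the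
  branches of \<open>u\<^sub>1\<close> and \<open>u\<^sub>2\<close> on \<open>s ` X\<close> are single-valued.
\<close>

definition inverted_by ::
  "(complex \<Rightarrow> complex) \<Rightarrow> complex set \<Rightarrow> (complex \<Rightarrow> complex) \<Rightarrow>
     (complex \<Rightarrow> complex) \<Rightarrow> (complex \<Rightarrow> complex) \<Rightarrow> bool" where
  "inverted_by V X s u1 u2 \<longleftrightarrow>
     second_order_solution V (s ` X) u1 \<and> second_order_solution V (s ` X) u2 \<and>
     lin_indep_on (s ` X) u1 u2 \<and>
     (\<forall>x\<in>X. u1 (s x) \<noteq> 0 \<and> x = u2 (s x) / u1 (s x))"

definition Q_of :: "(complex \<Rightarrow> complex) \<Rightarrow> complex \<Rightarrow> complex" where
  "Q_of P x = (P x)\<^sup>2 - 6 * deriv P x"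

definition nu_solution ::
  "(complex \<Rightarrow> complex) \<Rightarrow> complex set \<Rightarrow> (complex \<Rightarrow> complex) \<Rightarrow> bool" where
  "nu_solution P X \<nu> \<longleftrightarrow> \<nu> holomorphic_on X \<and>
     (\<forall>x\<in>X. (deriv ^^ 2) \<nu> x - 1 / 40 * Q_of P x * \<nu> x = 0)"

end

theory Submission
  imports Defs
begin

text \<open>
  Let \<open>g = v\<^sub>2 / v\<close> be the inverse of \<open>s\<close>. Since \<open>v\<close> and \<open>g v\<close> solve the same equation
  \<open>f'' + V f / 4 = 0\<close>, the factor \<open>g'' v + 2 g' v'\<close> vanishes, so for \<open>u = (\<nu> \<circ> g) v\<close> one gets
  \<open>u'' = (\<nu>'' \<circ> g) g'\<^sup>2 v + (\<nu> \<circ> g) v''\<close>. Hence the equation \<open>u'' + W u / 4 = 0\<close> is equivalent to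
  \<open>\<nu>'' = s'\<^sup>2 (V - W) \<nu> / 4\<close>, and the Schwarzian equation turns \<open>P\<^sup>2 - 6 P'\<close> into
  \<open>10 s'\<^sup>2 (V - W)\<close> when \<open>V\<close> and \<open>W\<close> are the potentials for \<open>k = 2/3\<close> and \<open>k = 2\<close>.
\<close>

text \<open>The terms are grouped by derivatives of \<open>h\<close>, because the formula is used
  twice. With \<open>h\<close> the identity and \<open>f\<close> the second solution
  \<open>v2\<close> it shows that the bracket after \<open>deriv h (g z)\<close> vanishes; with
  \<open>h\<close> = \<nu> that vanishing removes the first-derivative term.\<close>

lemma deriv2_comp_mult:
  fixes f g h v :: "complex \<Rightarrow> complex"
  assumes "open S" "open X" and h: "h holomorphic_on X" and g: "g holomorphic_on S"
    and v: "v holomorphic_on S" and sub: "g ` S \<subseteq> X"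
    and f: "\<And>w. w \<in> S \<Longrightarrow> f w = h (g w) * v w" and z: "z \<in> S"
  shows "(deriv ^^ 2) f z = (deriv ^^ 2) h (g z) * (deriv g z)\<^sup>2 * v z
           + deriv h (g z) * ((deriv ^^ 2) g z * v z + 2 * deriv g z * deriv v z)
           + h (g z) * (deriv ^^ 2) v z"
proof -
  have dh: "(h has_field_derivative deriv h y) (at y)"
    and ddh: "(deriv h has_field_derivative deriv (deriv h) y) (at y)" if "y \<in> X" for y
    using that assms(2) h by (auto intro!: holomorphic_derivI holomorphic_deriv)
  have dg: "(g has_field_derivative deriv g w) (at w)"
    and ddg: "(deriv g has_field_derivative deriv (deriv g) w) (at w)"
    and dv: "(v has_field_derivative deriv v w) (at w)"
    and ddv: "(deriv v has_field_derivative deriv (deriv v) w) (at w)" if "w \<in> S" for w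
    using that assms(1) g v by (auto intro!: holomorphic_derivI holomorphic_deriv)
  have gX: "g w \<in> X" if "w \<in> S" for w using that sub by auto
  have df: "deriv f w = deriv h (g w) * deriv g w * v w + h (g w) * deriv v w" if w: "w \<in> S" for w
  proof (rule DERIV_imp_deriv)
    have "((\<lambda>w. h (g w) * v w) has_field_derivative
        deriv h (g w) * deriv g w * v w + h (g w) * deriv v w) (at w)"
      by (rule derivative_eq_intros DERIV_chain2[OF dh] dg dv refl gX w)+ (simp add: algebra_simps)
    then show "(f has_field_derivative
        deriv h (g w) * deriv g w * v w + h (g w) * deriv v w) (at w)"
      by (rule has_field_derivative_transform_within_open[OF _ \<open>open S\<close> w]) (simp add: f)
  qed
  have "((\<lambda>w. deriv h (g w) * deriv g w * v w + h (g w) * deriv v w) has_field_derivative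
      (deriv (deriv h) (g z) * deriv g z * deriv g z + deriv h (g z) * deriv (deriv g) z) * v z
      + deriv h (g z) * deriv g z * deriv v z
      + deriv h (g z) * deriv g z * deriv v z + h (g z) * deriv (deriv v) z) (at z)"
    by (rule derivative_eq_intros DERIV_chain2[OF dh] DERIV_chain2[OF ddh] dg ddg dv ddv refl gX z)+
      (simp add: algebra_simps)
  then have "(deriv f has_field_derivative
      (deriv (deriv h) (g z) * deriv g z * deriv g z + deriv h (g z) * deriv (deriv g) z) * v z
      + deriv h (g z) * deriv g z * deriv v z
      + deriv h (g z) * deriv g z * deriv v z + h (g z) * deriv (deriv v) z) (at z)"
    by (rule has_field_derivative_transform_within_open[OF _ \<open>open S\<close> z]) (simp add: df)
  from DERIV_imp_deriv[OF this] show ?thesis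
    by (simp add: numeral_2_eq_2 algebra_simps)
qed

text \<open>In every family the exponent paired with a coefficient m is m/k or m/6. Both choices
  satisfy the quadratic relation, since 1/4 + 9/4 = 10/4 and 1/4 + 1/36 = 10/36. Permuting
  coefficients and exponents together preserves the pairing, so the seven unpermuted families
  suffice.\<close>

lemma chazy_families_exponents:
  assumes "(c, abc) \<in> chazy_families"
  shows "(\<Sum>i<3. c ! i) = 6"
    and "i < 3 \<Longrightarrow> (c ! i)\<^sup>2 / 4 + (abc (2/3) ! i)\<^sup>2 = 10 * (abc 2 ! i)\<^sup>2"
proof -
  obtain p d e where p: "p permutes {..<3}" and de: "(d, e) \<in> standard_families"
    and c: "c = permute_list p d" and abc: "abc = (\<lambda>k. permute_list p (e k))"
    using assms unfolding chazy_families_def by auto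
  have len: "length d = 3" "length (e k) = 3" for k
    using de unfolding standard_families_def by auto
  have nth: "c ! i = d ! p i" "abc k ! i = e k ! p i" if "i < 3" for i k
    using that p len by (auto simp: c abc permute_list_nth)
  have sum_d: "(\<Sum>i<3. d ! i) = 6"
    using de unfolding standard_families_def by (auto simp: eval_nat_numeral)
  have rel_d: "(d ! j)\<^sup>2 / 4 + (e (2/3) ! j)\<^sup>2 = 10 * (e 2 ! j)\<^sup>2" if "j < 3" for j
  proof -
    from that consider "j = 0" | "j = 1" | "j = 2" by linarith
    then show ?thesis
      using de unfolding standard_families_def by cases (auto simp: power2_eq_square)
  qed
  show "(\<Sum>i<3. c ! i) = 6"
    using sum.permute[OF p, of "\<lambda>i. d ! i"] sum_d nth by simp
  show "(c ! i)\<^sup>2 / 4 + (abc (2/3) ! i)\<^sup>2 = 10 * (abc 2 ! i)\<^sup>2" if "i < 3"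
    using rel_d[of "p i"] nth that permutes_in_image[OF p, of i] by simp
qed

text \<open>\<open>P\<close> is linear in L = s''/s', s'/s and s'/(s-1), and coefficients summing to
  6 give L the weight 3. This is exactly the weight for which every term containing L cancels in
  \<open>P\<close>^2 - 6 \<open>P\<close>', leaving s'^2 times a function of s.\<close>

lemma Q_of_w_combination:
  assumes "open X" and s: "schwarzian_solution V X s"
    and P: "\<And>t. t \<in> X \<Longrightarrow> P t = w_combination c s t"
    and c: "(\<Sum>i<3. c ! i) = 6" and x: "x \<in> X"
  shows "Q_of P x = (deriv s x)\<^sup>2 * (9 * V (s x) + ((c ! 1)\<^sup>2 / 4 - 9) / (s x)\<^sup>2
           + ((c ! 2)\<^sup>2 / 4 - 9) / (s x - 1)\<^sup>2
           + (9 + (c ! 0)\<^sup>2 / 4 - (c ! 1)\<^sup>2 / 4 - (c ! 2)\<^sup>2 / 4) / (s x * (s x - 1)))"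
proof -
  define L where "L = (\<lambda>t. deriv (deriv s) t / deriv s t)"
  have hol: "s holomorphic_on X" and nz: "\<And>t. t \<in> X \<Longrightarrow> deriv s t \<noteq> 0 \<and> s t \<noteq> 0 \<and> s t \<noteq> 1"
    and sch: "schwarzian s x + 1 / 2 * (deriv s x)\<^sup>2 * V (s x) = 0"
    using s x by (auto simp: schwarzian_solution_def)
  have hol': "deriv s holomorphic_on X" "deriv (deriv s) holomorphic_on X"
    using hol \<open>open X\<close> by (auto intro!: holomorphic_deriv)
  have ds: "(s has_field_derivative deriv s t) (at t)"
    and dds: "(deriv s has_field_derivative deriv (deriv s) t) (at t)" if "t \<in> X" for t
    using that \<open>open X\<close> hol hol' by (auto intro!: holomorphic_derivI)
  have "L holomorphic_on X"
    unfolding L_def using nz by (intro holomorphic_on_divide hol') auto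
  then have "(L has_field_derivative deriv L x) (at x)"
    using \<open>open X\<close> x by (auto intro!: holomorphic_derivI)
  \<comment> \<open>The Schwarzian equation, read as a Riccati equation for
    \<open>L\<close>.\<close>
  moreover have "deriv L x = (L x)\<^sup>2 / 2 - (deriv s x)\<^sup>2 * V (s x) / 2"
  proof -
    have "schwarzian s x = deriv L x - (L x)\<^sup>2 / 2"
      unfolding schwarzian_def L_def by (simp add: eval_nat_numeral)
    with sch show ?thesis by (simp add: algebra_simps eq_diff_eq flip: add_divide_distrib)
  qed
  ultimately have dL: "(L has_field_derivative
      (L x)\<^sup>2 / 2 - (deriv s x)\<^sup>2 * V (s x) / 2) (at x)" by simp
  \<comment> \<open>\<open>p\<close> is half of \<open>c ! 0 + c ! 2\<close>, the weight of s'/s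
    coming from \<open>w1\<close> and \<open>w3\<close>; \<open>q\<close> is half of
    \<open>c ! 0 + c ! 1\<close>, the weight of s'/(s-1) coming from \<open>w1\<close> and
    \<open>w2\<close>. The sum 6 eliminates \<open>c ! 0\<close>.\<close>
  define p q where "p = 3 - c ! 1 / 2" and "q = 3 - c ! 2 / 2"
  have c0: "c ! 0 = 6 - c ! 1 - c ! 2"
    using c by (simp add: eval_nat_numeral algebra_simps)
  have Pt: "P t = 3 * L t - p * (deriv s t / s t) - q * (deriv s t / (s t - 1))"
    if t: "t \<in> X" for t
  proof -
    note n = nz[OF t]
    have "((\<lambda>t. deriv s t / (s t * (s t - 1))) has_field_derivative
        (deriv (deriv s) t * (s t * (s t - 1)) - deriv s t * (deriv s t * (s t - 1) + s t * deriv s t))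
          / ((s t * (s t - 1)) * (s t * (s t - 1)))) (at t)"
      by (rule derivative_eq_intros ds dds refl t)+ (use n in auto)
    then have 1: "w1 s t = - 1/2 * (L t - deriv s t / s t - deriv s t / (s t - 1))"
      using n unfolding w1_def dlog_def L_def by (simp add: DERIV_imp_deriv divide_simps) algebra
    have "((\<lambda>t. deriv s t / (s t - 1)) has_field_derivative
        (deriv (deriv s) t * (s t - 1) - deriv s t * deriv s t)
          / ((s t - 1) * (s t - 1))) (at t)"
      by (rule derivative_eq_intros ds dds refl t)+ (use n in auto)
    then have 2: "w2 s t = - 1/2 * (L t - deriv s t / (s t - 1))"
      using n unfolding w2_def dlog_def L_def by (simp add: DERIV_imp_deriv divide_simps)
    have "((\<lambda>t. deriv s t / s t) has_field_derivative
        (deriv (deriv s) t * s t - deriv s t * deriv s t) / (s t * s t)) (at t)"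
      by (rule derivative_eq_intros ds dds refl t)+ (use n in auto)
    then have 3: "w3 s t = - 1/2 * (L t - deriv s t / s t)"
      using n unfolding w3_def dlog_def L_def by (simp add: DERIV_imp_deriv divide_simps)
    have "3 * l - p * a - q * b = - (c ! 0) * (- 1/2 * (l - a - b)) - c ! 1 * (- 1/2 * (l - b))
        - c ! 2 * (- 1/2 * (l - a))" for l a b
      unfolding p_def q_def c0 by (simp add: field_simps)
    then show ?thesis
      unfolding P[OF t] w_combination_def 1 2 3 by (simp only:)
  qed
  define a b where "a = deriv s x / s x" and "b = deriv s x / (s x - 1)"
  note n = nz[OF x]
  have da: "((\<lambda>t. deriv s t / s t) has_field_derivative L x * a - a\<^sup>2) (at x)"
    by (rule derivative_eq_intros ds dds refl x)+
      (use n in \<open>auto simp: a_def L_def divide_simps power2_eq_square\<close>)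
  have db: "((\<lambda>t. deriv s t / (s t - 1)) has_field_derivative L x * b - b\<^sup>2) (at x)"
    by (rule derivative_eq_intros ds dds refl x)+
      (use n in \<open>auto simp: b_def L_def divide_simps power2_eq_square\<close>)
  have "((\<lambda>t. 3 * L t - p * (deriv s t / s t) - q * (deriv s t / (s t - 1))) has_field_derivative
      3 * ((L x)\<^sup>2 / 2 - (deriv s x)\<^sup>2 * V (s x) / 2) - p * (L x * a - a\<^sup>2) - q * (L x * b - b\<^sup>2)) (at x)"
    by (intro DERIV_diff DERIV_cmult dL da db)
  then have "(P has_field_derivative
      3 * ((L x)\<^sup>2 / 2 - (deriv s x)\<^sup>2 * V (s x) / 2) - p * (L x * a - a\<^sup>2) - q * (L x * b - b\<^sup>2)) (at x)"
    by (rule has_field_derivative_transform_within_open[OF _ \<open>open X\<close> x]) (simp add: Pt)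
  then have dP: "deriv P x =
      3 * ((L x)\<^sup>2 / 2 - (deriv s x)\<^sup>2 * V (s x) / 2) - p * (L x * a - a\<^sup>2) - q * (L x * b - b\<^sup>2)"
    by (rule DERIV_imp_deriv)
  have Px: "P x = 3 * L x - p * a - q * b" using Pt[OF x] by (simp add: a_def b_def)
  \<comment> \<open>The square of \<open>3 * L x\<close> cancels against 6 * 3 * L^2/2 from the
    Riccati equation, and the products of \<open>L x\<close> with \<open>a\<close> and
    \<open>b\<close> cancel likewise.\<close>
  have "Q_of P x = 9 * (deriv s x)\<^sup>2 * V (s x)
      + (p\<^sup>2 - 6 * p) * a\<^sup>2 + (q\<^sup>2 - 6 * q) * b\<^sup>2 + 2 * p * q * (a * b)"
    unfolding Q_of_def dP Px by (simp add: power2_eq_square algebra_simps)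
  also have "p\<^sup>2 - 6 * p = (c ! 1)\<^sup>2 / 4 - 9"
    by (simp add: p_def power2_eq_square algebra_simps)
  also have "q\<^sup>2 - 6 * q = (c ! 2)\<^sup>2 / 4 - 9"
    by (simp add: q_def power2_eq_square algebra_simps)
  \<comment> \<open>Reintroducing \<open>c ! 0\<close> trades the mixed product of
    \<open>c ! 1\<close> and \<open>c ! 2\<close> for squares, the shape in which exponents enter
    the potential.\<close>
  also have "2 * p * q = 9 + (c ! 0)\<^sup>2 / 4 - (c ! 1)\<^sup>2 / 4 - (c ! 2)\<^sup>2 / 4"
    unfolding c0 by (simp add: p_def q_def power2_eq_square field_simps)
  finally have Q: "Q_of P x = 9 * (deriv s x)\<^sup>2 * V (s x) + ((c ! 1)\<^sup>2 / 4 - 9) * a\<^sup>2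
      + ((c ! 2)\<^sup>2 / 4 - 9) * b\<^sup>2
      + (9 + (c ! 0)\<^sup>2 / 4 - (c ! 1)\<^sup>2 / 4 - (c ! 2)\<^sup>2 / 4) * (a * b)" .
  have "d\<^sup>2 * (9 * W + A / y\<^sup>2 + B / z\<^sup>2 + C / (y * z))
      = 9 * d\<^sup>2 * W + A * (d / y)\<^sup>2 + B * (d / z)\<^sup>2 + C * ((d / y) * (d / z))"
    for d W A B C y z :: complex
    by (simp add: power_divide power2_eq_square distrib_left mult_ac)
  then show ?thesis
    unfolding Q a_def b_def by (simp only:)
qed

text \<open>Both sides are combinations of the same three fractions in s. The constants 9 cancel
  against those in 9 times the first potential, and the relation between the squares of coefficients
  and exponents then matches the remaining terms one by one.\<close>

lemma Q_of_chazy_family: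
  assumes "open X" and fam: "(c, abc) \<in> chazy_families"
    and s: "schwarzian_solution (potential (abc (2/3))) X s"
    and P: "\<And>t. t \<in> X \<Longrightarrow> P t = w_combination c s t" and x: "x \<in> X"
  shows "Q_of P x = 10 * (deriv s x)\<^sup>2 * (potential (abc (2/3)) (s x) - potential (abc 2) (s x))"
proof -
  note c = chazy_families_exponents[OF fam]
  have e0: "(c ! 0)\<^sup>2 / 4 = 10 * (abc 2 ! 0)\<^sup>2 - (abc (2/3) ! 0)\<^sup>2"
    and e1: "(c ! 1)\<^sup>2 / 4 = 10 * (abc 2 ! 1)\<^sup>2 - (abc (2/3) ! 1)\<^sup>2"
    and e2: "(c ! 2)\<^sup>2 / 4 = 10 * (abc 2 ! 2)\<^sup>2 - (abc (2/3) ! 2)\<^sup>2"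
    using c(2)[of 0] c(2)[of 1] c(2)[of 2] by (simp_all add: eq_diff_eq)
  define A B C where "A = 1 / (s x)\<^sup>2" and "B = 1 / (s x - 1)\<^sup>2" and "C = 1 / (s x * (s x - 1))"
  have pot: "potential l (s x) = (1 - (l ! 1)\<^sup>2) * A + (1 - (l ! 2)\<^sup>2) * B
      + ((l ! 1)\<^sup>2 + (l ! 2)\<^sup>2 - (l ! 0)\<^sup>2 - 1) * C" for l
    by (simp add: potential_def Let_def A_def B_def C_def)
  have "Q_of P x = (deriv s x)\<^sup>2 * (9 * potential (abc (2/3)) (s x) + ((c ! 1)\<^sup>2 / 4 - 9) * A
      + ((c ! 2)\<^sup>2 / 4 - 9) * B + (9 + (c ! 0)\<^sup>2 / 4 - (c ! 1)\<^sup>2 / 4 - (c ! 2)\<^sup>2 / 4) * C)"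
    unfolding A_def B_def C_def using Q_of_w_combination[OF \<open>open X\<close> s P c(1) x] by simp
  also have "\<dots> = 10 * (deriv s x)\<^sup>2 * (potential (abc (2/3)) (s x) - potential (abc 2) (s x))"
    unfolding pot e0 e1 e2 by (simp add: algebra_simps)
  finally show ?thesis .
qed

theorem theorem3p2:
  fixes X :: "complex set"
    and P s v v2 :: "complex \<Rightarrow> complex"
    and c :: "complex list"
    and abc :: "complex \<Rightarrow> complex list"
  assumes "open X" and "connected X" and "X \<noteq> {}"
    and "chazy_solution (2/3) X P"
    and "(c, abc) \<in> chazy_families"
    and "schwarzian_solution (potential (abc (2/3))) X s"
    and "\<forall>x\<in>X. P x = w_combination c s x"
    and "inverted_by (potential (abc (2/3))) X s v v2"
  shows "\<forall>\<nu>. nu_solution P X \<nu> \<longleftrightarrow>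
           (\<exists>u. second_order_solution (potential (abc 2)) (s ` X) u \<and>
                (\<forall>x\<in>X. \<nu> x = u (s x) / v (s x)))"
proof -
  define V W where "V = potential (abc (2/3))" and "W = potential (abc 2)"
  define S where "S = s ` X"
  define g where "g = (\<lambda>z. v2 z / v z)"
  have s: "s holomorphic_on X" and s': "\<And>x. x \<in> X \<Longrightarrow> deriv s x \<noteq> 0"
    using assms(6) by (auto simp: schwarzian_solution_def)
  have v: "v holomorphic_on S" and v2: "v2 holomorphic_on S"
    and ode_v: "\<And>z. z \<in> S \<Longrightarrow> (deriv ^^ 2) v z + 1 / 4 * V z * v z = 0"
    and ode_v2: "\<And>z. z \<in> S \<Longrightarrow> (deriv ^^ 2) v2 z + 1 / 4 * V z * v2 z = 0"
    and v0: "\<And>z. z \<in> S \<Longrightarrow> v z \<noteq> 0" and gs: "\<And>x. x \<in> X \<Longrightarrow> g (s x) = x"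
    using assms(8) by (auto simp: inverted_by_def second_order_solution_def S_def V_def g_def)
  \<comment> \<open>Injectivity makes the image \<open>S\<close> open, so that \<open>g\<close>,
    \<open>v\<close> and \<open>u\<close> can be differentiated there.\<close>
  have "inj_on s X" using gs by (metis inj_onI)
  then have "open S" unfolding S_def using open_mapping_thm3 s \<open>open X\<close> by blast
  have g: "g holomorphic_on S"
    unfolding g_def using v v2 v0 by (intro holomorphic_intros) auto
  have gX: "g ` S \<subseteq> X" using gs by (auto simp: S_def)
  have g's': "deriv g (s x) * deriv s x = 1" if x: "x \<in> X" for x
  proof -
    have "((\<lambda>x. g (s x)) has_field_derivative deriv g (s x) * deriv s x) (at x)"
      using x by (intro DERIV_chain2[of g] holomorphic_derivI[OF g \<open>open S\<close>]
          holomorphic_derivI[OF s \<open>open X\<close>]) (auto simp: S_def)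
    then have "((\<lambda>x. x) has_field_derivative deriv g (s x) * deriv s x) (at x)"
      by (rule has_field_derivative_transform_within_open[OF _ \<open>open X\<close> x]) (simp add: gs)
    then show ?thesis using DERIV_ident DERIV_unique by blast
  qed
  have cross: "(deriv ^^ 2) g z * v z + 2 * deriv g z * deriv v z = 0" if z: "z \<in> S" for z
  proof -
    have "(deriv ^^ 2) v2 z = (deriv ^^ 2) (\<lambda>t. t) (g z) * (deriv g z)\<^sup>2 * v z
        + deriv (\<lambda>t. t) (g z) * ((deriv ^^ 2) g z * v z + 2 * deriv g z * deriv v z)
        + g z * (deriv ^^ 2) v z"
      by (rule deriv2_comp_mult[OF \<open>open S\<close> \<open>open X\<close> _ g v gX _ z])
        (auto simp: g_def v0 intro: holomorphic_intros)
    moreover have "(deriv ^^ 2) v2 z = g z * (deriv ^^ 2) v z"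
    proof -
      have "v2 z = g z * v z" using v0[OF z] by (simp add: g_def)
      with ode_v[OF z] ode_v2[OF z] show ?thesis by algebra
    qed
    ultimately show ?thesis by (simp add: numeral_2_eq_2)
  qed
  \<comment> \<open>The two left-hand sides are proportional with a nonvanishing factor, so one
    identity serves both directions. \<open>u\<close> is prescribed on \<open>S\<close> only,
    because a given solution may take any values elsewhere.\<close>
  have key: "(deriv ^^ 2) u (s x) + 1 / 4 * W (s x) * u (s x) =
      (deriv g (s x))\<^sup>2 * v (s x) * ((deriv ^^ 2) \<nu> x - 1 / 40 * Q_of P x * \<nu> x)"
    if \<nu>: "\<nu> holomorphic_on X" and u: "\<And>z. z \<in> S \<Longrightarrow> u z = \<nu> (g z) * v z" and x: "x \<in> X"
    for u \<nu> x
  proof -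
    have z: "s x \<in> S" using x by (simp add: S_def)
    have Q: "Q_of P x = 10 * (deriv s x)\<^sup>2 * (V (s x) - W (s x))"
      unfolding V_def W_def by (rule Q_of_chazy_family[OF assms(1,5,6) _ x]) (use assms(7) in auto)
    have "(deriv ^^ 2) u (s x) = (deriv ^^ 2) \<nu> x * (deriv g (s x))\<^sup>2 * v (s x)
        + \<nu> x * (deriv ^^ 2) v (s x)"
      using deriv2_comp_mult[OF \<open>open S\<close> \<open>open X\<close> \<nu> g v gX u z]
      by (simp add: cross[OF z] gs[OF x])
    moreover have "u (s x) = \<nu> x * v (s x)" using u[OF z] gs[OF x] by simp
    moreover have "(deriv ^^ 2) v (s x) = - (1 / 4 * V (s x) * v (s x))"
      using ode_v[OF z] by (simp add: eq_neg_iff_add_eq_0)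
    \<comment> \<open>The factor 10, combined with the 1/4 in the second-order equations, produces
      the constant 1/40.\<close>
    moreover have "(deriv g (s x))\<^sup>2 * Q_of P x = 10 * (V (s x) - W (s x))"
      using g's'[OF x] unfolding Q by algebra
    ultimately show ?thesis by algebra
  qed
  have iff: "nu_solution P X \<nu> \<longleftrightarrow> second_order_solution W S u"
    if \<nu>: "\<nu> holomorphic_on X" and u: "\<And>z. z \<in> S \<Longrightarrow> u z = \<nu> (g z) * v z" for \<nu> u
  proof -
    have "(\<lambda>z. \<nu> (g z) * v z) holomorphic_on S"
      using holomorphic_on_compose_gen[OF g \<nu> gX] v
      by (intro holomorphic_on_mult) (auto simp: o_def)
    then have "u holomorphic_on S"
      by (subst holomorphic_cong[OF refl u])
    moreover have "deriv g (s x) \<noteq> 0 \<and> v (s x) \<noteq> 0" if "x \<in> X" for x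
      using g's'[OF that] v0[of "s x"] that by (auto simp: S_def)
    ultimately show ?thesis
      using \<nu> key[OF \<nu> u] unfolding nu_solution_def second_order_solution_def
      by (auto simp: S_def)
  qed
  show ?thesis
    unfolding V_def[symmetric] W_def[symmetric] S_def[symmetric]
  proof (intro allI iffI; (elim exE conjE)?)
    fix \<nu> assume \<nu>: "nu_solution P X \<nu>"
    then have "second_order_solution W S (\<lambda>z. \<nu> (g z) * v z)"
      using iff[of \<nu> "\<lambda>z. \<nu> (g z) * v z"] by (simp add: nu_solution_def)
    then show "\<exists>u. second_order_solution W S u \<and> (\<forall>x\<in>X. \<nu> x = u (s x) / v (s x))"
      using v0 gs by (intro exI[of _ "\<lambda>z. \<nu> (g z) * v z"]) (auto simp: S_def)
  next
    fix \<nu> u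
    assume u: "second_order_solution W S u" and \<nu>u: "\<forall>x\<in>X. \<nu> x = u (s x) / v (s x)"
    \<comment> \<open>\<open>iff\<close> presupposes that \<nu> is holomorphic; here this has to be
      recovered from the quotient.\<close>
    have "(\<lambda>x. u (s x) / v (s x)) holomorphic_on X"
      using holomorphic_on_compose_gen[OF s _ , of _ S] u v v0
      by (intro holomorphic_on_divide) (auto simp: S_def o_def second_order_solution_def)
    then have "\<nu> holomorphic_on X"
      using \<nu>u by (subst holomorphic_cong[OF refl]) auto
    moreover have "u z = \<nu> (g z) * v z" if "z \<in> S" for z
      using that v0[OF that] \<nu>u gs by (auto simp: S_def)
    ultimately show "nu_solution P X \<nu>" using iff u by blast
  qed
qed

end
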